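(* Every infinite dimensional vector space $V$ over a field is age indivisible; that is, for every partition $(P_0,P_1)$ of $V$ there is an $i\in\{0,1\}$ with $\mathrm{age}(V{\restriction}P_i)=\mathrm{age}(V)$.
   Context: The affine cycle structure of $V$: a finite sequence $\langle v_i:i\in n\rangle$ of affinely dependent elements of $V$ is an affine cycle if no proper subsequence is affinely dependent. Two affine cycles $\langle v_i:i\in n\rangle$ and $\langle v_i':i\in n\rangle$ are equivalent if there is an invertible affine transformation $\tau$ from the affine space generated by $\{v_i:i\in n\}$ onto the affine space generated by $\{v'_i:i\in n\}$ with $\tau(v_i)=v_i'$ for all $i\in n$. The affine cycle structure of $V$ is the relational structure with base set $V$ having each equivalence class of affine cycles as a relation. The age of a relational structure is the class of finite relational structures isomorphic to one of its induced substructures on a nonempty finite subset of the base set. For $P\subseteq V$, $\mathrm{age}(V{\restriction}P)$ denotes the age of the substructure of the affine cycle structure of $V$ induced on $P$, and $\mathrm{age}(V)=\mathrm{age}(V{\restriction}V)$. *)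

theory Defs
  imports Main "HOL.Vector_Spaces" "HOL-Library.Sublist"
begin

section \<open>Relational structures and ages\<close>

text \<open>
  Tuples are lists, and \<open>'r\<close> is the type of relation symbols.  A term of type \<open>'r\<close> that is not
  meant to be a symbol is interpreted by the empty relation.
\<close>

record ('r, 'a) relstruct =
  base :: "'a set"
  rels :: "'r \<Rightarrow> 'a list set"

definition is_relstruct :: "('r, 'a) relstruct \<Rightarrow> bool" where
  "is_relstruct M \<longleftrightarrow>
     (\<forall>r. \<exists>n. \<forall>xs\<in>rels M r. length xs = n \<and> set xs \<subseteq> base M)"

definition induced :: "('r, 'a) relstruct \<Rightarrow> 'a set \<Rightarrow> ('r, 'a) relstruct" where
  "induced M P = \<lparr>base = base M \<inter> P, rels = (\<lambda>r. {xs \<in> rels M r. set xs \<subseteq> P})\<rparr>"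

definition isomorphic :: "('r, 'a) relstruct \<Rightarrow> ('r, 'b) relstruct \<Rightarrow> bool" where
  "isomorphic M N \<longleftrightarrow>
     (\<exists>f. bij_betw f (base M) (base N) \<and>
          (\<forall>r xs. set xs \<subseteq> base M \<longrightarrow> (xs \<in> rels M r \<longleftrightarrow> map f xs \<in> rels N r)))"

text \<open>
  The age is a proper class closed under isomorphism; since its members are finite, it is
  represented without loss by its members whose base set is a set of natural numbers.
\<close>

definition age :: "('r, 'a) relstruct \<Rightarrow> ('r, nat) relstruct set" where
  "age M = {N. is_relstruct N \<and> finite (base N) \<and>
               (\<exists>A. A \<subseteq> base M \<and> A \<noteq> {} \<and> finite A \<and> isomorphic N (induced M A))}"

definition age_indivisible :: "('r, 'a) relstruct \<Rightarrow> bool" where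
  "age_indivisible M \<longleftrightarrow>
     (\<forall>P :: nat \<Rightarrow> 'a set. P 0 \<union> P 1 = base M \<and> P 0 \<inter> P 1 = {} \<longrightarrow>
        (\<exists>i\<in>{0, 1}. age (induced M (P i)) = age M))"


section \<open>The affine cycle structure of a vector space\<close>

context vector_space
begin

definition infinite_dimensional :: bool where
  "infinite_dimensional \<longleftrightarrow> \<not> (\<exists>B. finite B \<and> independent B \<and> span B = UNIV)"

definition aff_hull :: "'b set \<Rightarrow> 'b set" where
  "aff_hull S = {\<Sum>x\<in>T. c x *s x | T c. finite T \<and> T \<subseteq> S \<and> sum c T = 1}"

definition affine_map_on :: "'b set \<Rightarrow> ('b \<Rightarrow> 'b) \<Rightarrow> bool" where
  "affine_map_on A f \<longleftrightarrow>
     (\<forall>T c. finite T \<and> T \<subseteq> A \<and> sum c T = 1 \<longrightarrow>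
        f (\<Sum>x\<in>T. c x *s x) = (\<Sum>x\<in>T. c x *s f x))"

text \<open>
  Affine dependence is that of an indexed family, so a sequence with a repeated entry is
  dependent; in particular \<open>[v, v]\<close> is an affine cycle.
\<close>

definition affinely_dependent :: "'b list \<Rightarrow> bool" where
  "affinely_dependent vs \<longleftrightarrow>
     (\<exists>c :: nat \<Rightarrow> 'a. (\<exists>i<length vs. c i \<noteq> 0) \<and>
        (\<Sum>i<length vs. c i) = 0 \<and> (\<Sum>i<length vs. c i *s vs ! i) = 0)"

definition affine_cycles :: "'b list set" where
  "affine_cycles =
     {vs. affinely_dependent vs \<and> (\<forall>us. strict_subseq us vs \<longrightarrow> \<not> affinely_dependent us)}"

definition cycle_equiv :: "('b list \<times> 'b list) set" where
  "cycle_equiv =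
     {(vs, ws). vs \<in> affine_cycles \<and> ws \<in> affine_cycles \<and> length vs = length ws \<and>
        (\<exists>f. affine_map_on (aff_hull (set vs)) f \<and>
             bij_betw f (aff_hull (set vs)) (aff_hull (set ws)) \<and>
             (\<forall>i<length vs. f (vs ! i) = ws ! i))}"

text \<open>The relation symbols are the equivalence classes themselves.\<close>

definition affine_cycle_structure :: "('b list set, 'b) relstruct" where
  "affine_cycle_structure =
     \<lparr>base = UNIV, rels = (\<lambda>R. if R \<in> affine_cycles // cycle_equiv then R else {})\<rparr>"

end

end

theory Submission
  imports Defs "HOL-Library.FuncSet"
begin

text \<open>
  An injective affine self-map \<open>\<tau>\<close> of \<open>V\<close> preserves affine dependence in both directions and
  carries every affine cycle to an equivalent one, so \<open>A\<close> and \<open>\<tau> ` A\<close> induce isomorphic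
  substructures (\<open>isomorphic_induced_image\<close>).  It is therefore enough that one of the two parts
  contains an injective affine image of every finite subset of \<open>V\<close>.

  Every finite \<open>A\<close> has such an image in at least one part, by the Hales-Jewett theorem with
  alphabet \<open>A\<close>.  As \<open>V\<close> is infinite dimensional, it contains countably many independent
  copies of itself: there are linear embeddings \<open>\<phi> j\<close> whose images are in direct sum.  The word
  \<open>w\<close> is placed at the vector \<open>\<Sum>j. \<phi> j (w ! j)\<close>.  Along a combinatorial line with set \<open>J\<close> of
  active positions the letter \<open>a\<close> then goes to \<open>(\<Sum>j\<in>J. \<phi> j a) + v\<close> for a fixed vector \<open>v\<close>, an
  injective affine function of \<open>a\<close>; so a monochromatic line is a monochromatic affine copy of
  \<open>A\<close> (\<open>monochromatic_affine_copy\<close>).  The field may be infinite because only the points of \<open>A\<close>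
  are letters, not the subspace that they generate.

  The part can be chosen independently of \<open>A\<close>: if \<open>A\<close> had no copy in the first part and \<open>B\<close>
  none in the second, then \<open>A \<union> B\<close> would have a copy in neither.

  The Hales-Jewett theorem itself is proved by induction on the alphabet with colour focusing
  (\<open>colour_focusing\<close>).
\<close>

section \<open>The Hales-Jewett theorem\<close>

text \<open>
  A combinatorial line is a word with wildcards: \<open>None\<close> marks the active positions, and
  \<open>Some b\<close> a position with constant letter \<open>b\<close>.
\<close>

definition fill :: "'a option list \<Rightarrow> 'a \<Rightarrow> 'a list" where
  "fill T a = map (case_option a id) T"

definition is_line :: "'a set \<Rightarrow> nat \<Rightarrow> 'a option list \<Rightarrow> bool" where
  "is_line A n T \<longleftrightarrow> length T = n \<and> None \<in> set T \<and> set T \<subseteq> insert None (Some ` A)"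

definition words :: "'a set \<Rightarrow> nat \<Rightarrow> 'a list set" where
  "words A n = {w. set w \<subseteq> A \<and> length w = n}"

definition mono_line :: "'a set \<Rightarrow> nat \<Rightarrow> ('a list \<Rightarrow> 'c) \<Rightarrow> bool" where
  "mono_line A n \<chi> \<longleftrightarrow> (\<exists>T c. is_line A n T \<and> (\<forall>a\<in>A. \<chi> (fill T a) = c))"

definition hales_jewett :: "'a set \<Rightarrow> bool" where
  "hales_jewett A \<longleftrightarrow>
     (\<forall>r. \<exists>n. \<forall>\<chi> :: 'a list \<Rightarrow> nat. (\<forall>w\<in>words A n. \<chi> w < r) \<longrightarrow> mono_line A n \<chi>)"

lemma fill_append [simp]: "fill (S @ T) a = fill S a @ fill T a"
  by (simp add: fill_def)

lemma fill_map_Some [simp]: "fill (map Some w) a = w"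
  by (induction w) (simp_all add: fill_def)

lemma length_fill [simp]: "length (fill T a) = length T"
  by (simp add: fill_def)

lemma finite_words: "finite A \<Longrightarrow> finite (words A n)"
  by (simp add: words_def finite_lists_length_eq)

lemma words_append: "u \<in> words A m \<Longrightarrow> w \<in> words A n \<Longrightarrow> u @ w \<in> words A (m + n)"
  by (auto simp: words_def)

lemma words_mono: "w \<in> words A n \<Longrightarrow> A \<subseteq> B \<Longrightarrow> w \<in> words B n"
  by (auto simp: words_def)

lemma fill_in_words:
  assumes "is_line A n T" and "A \<subseteq> B" and "a \<in> B"
  shows "fill T a \<in> words B n"
proof -
  have "set T \<subseteq> insert None (Some ` B)" using assms unfolding is_line_def by blast
  then have "set (fill T a) \<subseteq> B" using assms(3) by (auto simp: fill_def split: option.split)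
  then show ?thesis using assms(1) by (simp add: words_def is_line_def)
qed

lemma is_line_append: "is_line A m S \<Longrightarrow> is_line A n T \<Longrightarrow> is_line A (m + n) (S @ T)"
  by (auto simp: is_line_def)

lemma is_line_append_word: "is_line A m S \<Longrightarrow> w \<in> words A n \<Longrightarrow> is_line A (m + n) (S @ map Some w)"
  by (auto simp: is_line_def words_def)

lemma is_line_word_append: "w \<in> words A m \<Longrightarrow> is_line A n T \<Longrightarrow> is_line A (m + n) (map Some w @ T)"
  by (auto simp: is_line_def words_def)

lemma is_line_mono: "is_line A n T \<Longrightarrow> A \<subseteq> B \<Longrightarrow> is_line B n T"
  unfolding is_line_def by blast

text \<open>
  The colours of a product colouring are functions, so the bounded number of colours is
  generalized from numbers below \<open>r\<close> to elements of a finite set.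
\<close>

lemma hales_jewett_finite_colours:
  assumes "hales_jewett A" and "finite S"
  obtains n where "\<And>\<chi> :: 'a list \<Rightarrow> 'c. (\<And>w. w \<in> words A n \<Longrightarrow> \<chi> w \<in> S) \<Longrightarrow>
    \<exists>T. is_line A n T \<and> (\<forall>a\<in>A. \<forall>b\<in>A. \<chi> (fill T a) = \<chi> (fill T b))"
proof -
  obtain h where h: "bij_betw h S {0..<card S}"
    using ex_bij_betw_finite_nat[OF \<open>finite S\<close>] by blast
  obtain n where n: "\<And>\<chi> :: 'a list \<Rightarrow> nat. (\<forall>w\<in>words A n. \<chi> w < card S) \<Longrightarrow> mono_line A n \<chi>"
    using assms(1) unfolding hales_jewett_def by meson
  show thesis
  proof (rule that)
    fix \<chi> :: "'a list \<Rightarrow> 'c"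
    assume S: "\<And>w. w \<in> words A n \<Longrightarrow> \<chi> w \<in> S"
    have "\<forall>w\<in>words A n. (h \<circ> \<chi>) w < card S"
      using S h by (auto simp: bij_betw_def)
    from n[OF this] obtain T c
      where T: "is_line A n T" and c: "\<forall>a\<in>A. h (\<chi> (fill T a)) = c"
      unfolding mono_line_def by auto
    have "\<chi> (fill T a) = \<chi> (fill T b)" if "a \<in> A" "b \<in> A" for a b
      using c that S fill_in_words[OF T order_refl] inj_onD[OF bij_betw_imp_inj_on[OF h]] by metis
    with T show "\<exists>T. is_line A n T \<and> (\<forall>a\<in>A. \<forall>b\<in>A. \<chi> (fill T a) = \<chi> (fill T b))" by blast
  qed
qed

text \<open>
  Lines through a common point \<open>f\<close> at the letter \<open>a\<close>, one for each colour in \<open>C\<close> and each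
  monochromatic on \<open>A\<close>.  The colour of \<open>f\<close> itself is left open: if it is in
  \<open>C\<close>, one of the lines is monochromatic on the whole alphabet.
\<close>

definition focused :: "'a set \<Rightarrow> 'a \<Rightarrow> nat \<Rightarrow> ('a list \<Rightarrow> nat) \<Rightarrow> 'a list \<Rightarrow> nat set \<Rightarrow> bool" where
  "focused A a n \<chi> f C \<longleftrightarrow> f \<in> words (insert a A) n \<and>
     (\<forall>c\<in>C. \<exists>T. is_line (insert a A) n T \<and> fill T a = f \<and> (\<forall>b\<in>A. \<chi> (fill T b) = c))"

lemma focus_colour_new:
  assumes "focused A a n \<chi> f C" and "\<not> mono_line (insert a A) n \<chi>"
  shows "\<chi> f \<notin> C"
  using assms unfolding focused_def mono_line_def by fastforce

text \<open>
  When \<open>b\<close> varies along \<open>T\<close> inside \<open>A\<close>, the colouring of all continuations \<open>y\<close> stays the same.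
  Hence the lines focused at \<open>f\<close> for that common colouring can be run in parallel with \<open>T\<close>
  without changing their colours, and they then meet at \<open>fill T a @ f\<close>.  Running \<open>T\<close> alone, with
  \<open>f\<close> held constant, gives one more line with this focus, whose colour is that of \<open>f\<close>.
\<close>

lemma focusing_step:
  fixes \<chi> :: "'a list \<Rightarrow> nat"
  assumes T: "is_line A m T" and "b \<in> A"
    and T_mono: "\<And>b' y. b' \<in> A \<Longrightarrow> y \<in> words (insert a A) n \<Longrightarrow> \<chi> (fill T b' @ y) = \<chi> (fill T b @ y)"
    and foc: "focused A a n (\<lambda>y. \<chi> (fill T b @ y)) f C"
  shows "focused A a (m + n) \<chi> (fill T a @ f) (insert (\<chi> (fill T b @ f)) C)"
proof -
  let ?B = "insert a A"
  have T': "is_line ?B m T" using T by (rule is_line_mono) blast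
  have f: "f \<in> words ?B n" using foc by (simp add: focused_def)
  have "\<exists>U. is_line ?B (m + n) U \<and> fill U a = fill T a @ f \<and> (\<forall>b\<in>A. \<chi> (fill U b) = c)"
    if c: "c \<in> insert (\<chi> (fill T b @ f)) C" for c
  proof (cases "c \<in> C")
    case True
    then obtain L where L: "is_line ?B n L" "fill L a = f" "\<forall>b'\<in>A. \<chi> (fill T b @ fill L b') = c"
      using foc unfolding focused_def by blast
    have "\<chi> (fill T b' @ fill L b') = c" if "b' \<in> A" for b'
      using that L T_mono[OF that] fill_in_words[OF L(1) order_refl] by simp
    then show ?thesis
      using L by (intro exI[of _ "T @ L"]) (simp add: is_line_append[OF T'])
  next
    case False
    then have "c = \<chi> (fill T b @ f)" using c by blast
    then show ?thesis
      using f T_mono by (intro exI[of _ "T @ map Some f"]) (simp add: is_line_append_word[OF T'])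
  qed
  moreover have "fill T a @ f \<in> words ?B (m + n)"
    using words_append fill_in_words[OF T' order_refl] f by blast
  ultimately show ?thesis by (simp add: focused_def)
qed

text \<open>
  In the step, the induction hypothesis on the alphabet is applied to the product colouring that
  sends a word \<open>x\<close> over \<open>A\<close> to the colouring of all its continuations.  This has finitely many
  values because the length \<open>n\<close> that yields \<open>s\<close> colours is fixed before the length of \<open>x\<close>.
\<close>

lemma colour_focusing:
  assumes "finite A" and "A \<noteq> {}" and hj: "hales_jewett A"
  shows "\<exists>n. \<forall>\<chi> :: 'a list \<Rightarrow> nat. (\<forall>w\<in>words (insert a A) n. \<chi> w < r) \<longrightarrow>
    mono_line (insert a A) n \<chi> \<or> (\<exists>f C. focused A a n \<chi> f C \<and> C \<subseteq> {..<r} \<and> card C = s)"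
proof (induction s)
  case 0
  have "focused A a 0 \<chi> [] {}" for \<chi> by (simp add: focused_def words_def)
  then show ?case by (intro exI[of _ 0]) force
next
  case (Suc s)
  let ?B = "insert a A"
  from Suc obtain n where n: "\<And>\<chi> :: 'a list \<Rightarrow> nat. (\<forall>w\<in>words ?B n. \<chi> w < r) \<Longrightarrow>
      mono_line ?B n \<chi> \<or> (\<exists>f C. focused A a n \<chi> f C \<and> C \<subseteq> {..<r} \<and> card C = s)"
    by meson
  let ?S = "words ?B n \<rightarrow>\<^sub>E {..<r}"
  have "finite ?S" using \<open>finite A\<close> by (intro finite_PiE finite_words) auto
  from hales_jewett_finite_colours[OF hj this] obtain m
    where m: "\<And>\<chi> :: 'a list \<Rightarrow> 'a list \<Rightarrow> nat. (\<And>w. w \<in> words A m \<Longrightarrow> \<chi> w \<in> ?S) \<Longrightarrow>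
      \<exists>T. is_line A m T \<and> (\<forall>a\<in>A. \<forall>b\<in>A. \<chi> (fill T a) = \<chi> (fill T b))"
    by blast
  obtain b where b: "b \<in> A" using \<open>A \<noteq> {}\<close> by blast
  show ?case
  proof (intro exI[of _ "m + n"] allI impI)
    fix \<chi> :: "'a list \<Rightarrow> nat"
    assume bound: "\<forall>w\<in>words ?B (m + n). \<chi> w < r"
    let ?prod = "\<lambda>x. restrict (\<lambda>y. \<chi> (x @ y)) (words ?B n)"
    have "?prod x \<in> ?S" if "x \<in> words A m" for x
    proof -
      have "x \<in> words ?B m" using that words_mono by blast
      then show ?thesis using bound words_append[of x ?B m _ n] by auto
    qed
    from m[of ?prod, OF this] obtain T where T: "is_line A m T"
      and eq: "\<And>a b. a \<in> A \<Longrightarrow> b \<in> A \<Longrightarrow> ?prod (fill T a) = ?prod (fill T b)"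
      by blast
    have T_mono: "\<chi> (fill T b' @ y) = \<chi> (fill T b @ y)" if "b' \<in> A" "y \<in> words ?B n" for b' y
      using fun_cong[OF eq[OF that(1) b], of y] that(2) by simp
    have Tb: "fill T b \<in> words ?B m" using fill_in_words[OF T] b by blast
    let ?\<psi> = "\<lambda>y. \<chi> (fill T b @ y)"
    have \<psi>_bound: "\<forall>w\<in>words ?B n. ?\<psi> w < r" using bound words_append[OF Tb] by blast
    show "mono_line ?B (m + n) \<chi> \<or>
      (\<exists>f C. focused A a (m + n) \<chi> f C \<and> C \<subseteq> {..<r} \<and> card C = Suc s)"
    proof (cases "mono_line ?B n ?\<psi>")
      case True
      then obtain L c where "is_line ?B n L" "\<forall>b'\<in>?B. ?\<psi> (fill L b') = c"
        unfolding mono_line_def by blast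
      then have "mono_line ?B (m + n) \<chi>"
        unfolding mono_line_def using is_line_word_append[OF Tb]
        by (intro exI[of _ "map Some (fill T b) @ L"] exI[of _ c]) simp
      then show ?thesis ..
    next
      case False
      with n[OF \<psi>_bound] obtain f C
        where foc: "focused A a n ?\<psi> f C" and C: "C \<subseteq> {..<r}" "card C = s" by blast
      have "?\<psi> f \<notin> C" using focus_colour_new[OF foc False] .
      moreover have "?\<psi> f < r" using \<psi>_bound foc by (simp add: focused_def)
      moreover have "finite C" using C(1) finite_subset by blast
      ultimately have "insert (?\<psi> f) C \<subseteq> {..<r} \<and> card (insert (?\<psi> f) C) = Suc s"
        using C by auto
      with focusing_step[OF T b T_mono foc] show ?thesis by blast
    qed
  qed
qed

text \<open>
  With \<open>r\<close> focused lines of distinct colours every colour is taken, so the focus has the colour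
  of one of them.
\<close>

theorem hales_jewett_theorem:
  assumes "finite A" and "A \<noteq> {}"
  shows "hales_jewett A"
  using assms
proof (induction A rule: finite_ne_induct)
  case (singleton a)
  have "mono_line {a} 1 \<chi>" for \<chi> :: "'a list \<Rightarrow> nat"
    unfolding mono_line_def by (intro exI[of _ "[None]"]) (auto simp: is_line_def)
  then show ?case unfolding hales_jewett_def by blast
next
  case (insert a A)
  show ?case
    unfolding hales_jewett_def
  proof
    fix r
    from colour_focusing[OF insert(1,2) insert.IH, of a r r] obtain n
      where n: "\<And>\<chi> :: 'a list \<Rightarrow> nat. (\<forall>w\<in>words (insert a A) n. \<chi> w < r) \<Longrightarrow>
        mono_line (insert a A) n \<chi> \<or> (\<exists>f C. focused A a n \<chi> f C \<and> C \<subseteq> {..<r} \<and> card C = r)"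
      by meson
    have "mono_line (insert a A) n \<chi>"
      if bound: "\<forall>w\<in>words (insert a A) n. \<chi> w < r" for \<chi> :: "'a list \<Rightarrow> nat"
    proof (rule ccontr)
      assume no: "\<not> mono_line (insert a A) n \<chi>"
      with n[OF bound] obtain f C
        where foc: "focused A a n \<chi> f C" and C: "C \<subseteq> {..<r}" "card C = r" by blast
      have "C = {..<r}" using C by (intro card_subset_eq) auto
      moreover have "\<chi> f < r" using bound foc by (simp add: focused_def)
      ultimately show False using focus_colour_new[OF foc no] by simp
    qed
    then show "\<exists>n. \<forall>\<chi> :: 'a list \<Rightarrow> nat. (\<forall>w\<in>words (insert a A) n. \<chi> w < r) \<longrightarrow>
        mono_line (insert a A) n \<chi>" by blast
  qed
qed

section \<open>Affine maps and affine cycles\<close>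

context vector_space
begin

definition affine_endo :: "('b \<Rightarrow> 'b) \<Rightarrow> bool" where
  "affine_endo \<tau> \<longleftrightarrow> (\<exists>f v. Vector_Spaces.linear scale scale f \<and> \<tau> = (\<lambda>x. f x + v))"

lemma affine_endo_imp_affine_map_on:
  assumes "affine_endo \<tau>"
  shows "affine_map_on A \<tau>"
proof -
  obtain f v where f: "Vector_Spaces.linear scale scale f" and \<tau>: "\<tau> = (\<lambda>x. f x + v)"
    using assms unfolding affine_endo_def by blast
  interpret f: Vector_Spaces.linear scale scale f by (rule f)
  show ?thesis
    unfolding affine_map_on_def \<tau>
    by (auto simp: f.sum f.scale scale_right_distrib sum.distrib simp flip: scale_sum_left)
qed

lemma affinely_dependent_map:
  assumes "affine_endo \<tau>" and "affinely_dependent xs"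
  shows "affinely_dependent (map \<tau> xs)"
proof -
  obtain f v where f: "Vector_Spaces.linear scale scale f" and \<tau>: "\<tau> = (\<lambda>x. f x + v)"
    using assms(1) unfolding affine_endo_def by blast
  interpret f: Vector_Spaces.linear scale scale f by (rule f)
  obtain c where c: "\<exists>i<length xs. c i \<noteq> 0" "(\<Sum>i<length xs. c i) = 0"
    "(\<Sum>i<length xs. c i *s xs ! i) = 0"
    using assms(2) unfolding affinely_dependent_def by blast
  have "(\<Sum>i<length xs. c i *s map \<tau> xs ! i) = (\<Sum>i<length xs. c i *s f (xs ! i) + c i *s v)"
    by (intro sum.cong) (auto simp: \<tau> scale_right_distrib)
  also have "\<dots> = f (\<Sum>i<length xs. c i *s xs ! i) + (\<Sum>i<length xs. c i) *s v"
    by (simp add: f.sum f.scale sum.distrib scale_sum_left)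
  also have "\<dots> = 0" using c by simp
  finally show ?thesis using c unfolding affinely_dependent_def by auto
qed

text \<open>
  The left inverse \<open>\<sigma>\<close> is only required to be affine and to undo \<open>\<tau>\<close> on the points at hand.  The
  assumptions are then symmetric under exchanging \<open>(\<tau>, \<sigma>, xs)\<close> with \<open>(\<sigma>, \<tau>, map \<tau> xs)\<close>, so the
  statement that \<open>\<tau>\<close> preserves cycles or their classes contains its own converse, although \<open>\<tau>\<close>
  need not be onto.
\<close>

lemma in_affine_cycles_map:
  assumes \<tau>: "affine_endo \<tau>" and \<sigma>: "affine_endo \<sigma>" and inv: "\<And>x. x \<in> set xs \<Longrightarrow> \<sigma> (\<tau> x) = x"
    and xs: "xs \<in> affine_cycles"
  shows "map \<tau> xs \<in> affine_cycles"
proof -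
  have "\<not> affinely_dependent us" if us: "strict_subseq us (map \<tau> xs)" for us
  proof
    assume dep: "affinely_dependent us"
    have inv': "map \<sigma> (map \<tau> xs) = xs" using inv by (simp add: map_idI)
    have sub: "subseq us (map \<tau> xs)" and ne: "us \<noteq> map \<tau> xs"
      using us by (auto simp: strict_subseq_def)
    have "set us \<subseteq> set (map \<tau> xs)" using sub by (auto elim: list_emb_set)
    then have "map \<tau> (map \<sigma> us) = us" using inv by (auto intro!: map_idI)
    then have "map \<sigma> us \<noteq> xs" using ne by auto
    moreover have "subseq (map \<sigma> us) xs" using subseq_map[OF sub, of \<sigma>] inv' by simp
    ultimately have "strict_subseq (map \<sigma> us) xs" by (simp add: strict_subseq_def)
    then show False using xs affinely_dependent_map[OF \<sigma> dep] unfolding affine_cycles_def by blast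
  qed
  then show ?thesis
    using xs affinely_dependent_map[OF \<tau>] unfolding affine_cycles_def by blast
qed

lemma affine_endo_aff_hull:
  assumes \<tau>: "affine_endo \<tau>" and inj: "inj_on \<tau> S" and x: "x \<in> aff_hull S"
  shows "\<tau> x \<in> aff_hull (\<tau> ` S)"
proof -
  obtain T c where T: "finite T" "T \<subseteq> S" and c: "sum c T = 1" and x: "x = (\<Sum>y\<in>T. c y *s y)"
    using x unfolding aff_hull_def by blast
  have injT: "inj_on \<tau> T" using inj T(2) inj_on_subset by blast
  \<comment> \<open>A combination is indexed by its points, so its coefficients must be moved to the images.\<close>
  let ?c = "c \<circ> inv_into T \<tau>"
  have "\<tau> x = (\<Sum>y\<in>T. c y *s \<tau> y)"
    using affine_endo_imp_affine_map_on[OF \<tau>, of UNIV] T c x unfolding affine_map_on_def by blast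
  also have "\<dots> = (\<Sum>z\<in>\<tau> ` T. ?c z *s z)"
    using injT by (simp add: sum.reindex)
  finally have "\<tau> x = (\<Sum>z\<in>\<tau> ` T. ?c z *s z)" .
  moreover have "sum ?c (\<tau> ` T) = 1" using injT c by (simp add: sum.reindex)
  moreover have "finite (\<tau> ` T)" "\<tau> ` T \<subseteq> \<tau> ` S" using T by auto
  ultimately show ?thesis unfolding aff_hull_def by blast
qed

lemma left_inverse_aff_hull:
  assumes \<tau>: "affine_endo \<tau>" and \<sigma>: "affine_endo \<sigma>" and inv: "\<And>x. x \<in> S \<Longrightarrow> \<sigma> (\<tau> x) = x"
    and x: "x \<in> aff_hull S"
  shows "\<sigma> (\<tau> x) = x"
proof -
  interpret vector_space_pair scale scale ..
  obtain f v where f: "Vector_Spaces.linear scale scale f" "\<tau> = (\<lambda>x. f x + v)"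
    using \<tau> unfolding affine_endo_def by blast
  obtain g w where g: "Vector_Spaces.linear scale scale g" "\<sigma> = (\<lambda>x. g x + w)"
    using \<sigma> unfolding affine_endo_def by blast
  have "\<sigma> \<circ> \<tau> = (\<lambda>x. (g \<circ> f) x + (g v + w))"
    using f g by (auto simp: fun_eq_iff linear_add)
  then have "affine_endo (\<sigma> \<circ> \<tau>)"
    unfolding affine_endo_def using Vector_Spaces.linear_compose[OF f(1) g(1)] by blast
  then have aff: "affine_map_on S (\<sigma> \<circ> \<tau>)" by (rule affine_endo_imp_affine_map_on)
  obtain T c where T: "finite T" "T \<subseteq> S" and c: "sum c T = 1" and x: "x = (\<Sum>y\<in>T. c y *s y)"
    using x unfolding aff_hull_def by blast
  have "(\<sigma> \<circ> \<tau>) x = (\<Sum>y\<in>T. c y *s (\<sigma> \<circ> \<tau>) y)"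
    using aff T c x unfolding affine_map_on_def by blast
  also have "\<dots> = x" unfolding x using T inv by (intro sum.cong) auto
  finally show ?thesis by simp
qed

lemma cycle_equiv_map:
  assumes \<tau>: "affine_endo \<tau>" and \<sigma>: "affine_endo \<sigma>" and inv: "\<And>x. x \<in> set xs \<Longrightarrow> \<sigma> (\<tau> x) = x"
    and xs: "xs \<in> affine_cycles"
  shows "(xs, map \<tau> xs) \<in> cycle_equiv"
proof -
  let ?H = "aff_hull (set xs)" and ?K = "aff_hull (set (map \<tau> xs))"
  have inv': "\<tau> (\<sigma> y) = y" if "y \<in> set (map \<tau> xs)" for y using that inv by auto
  have inj: "inj_on \<tau> (set xs)" "inj_on \<sigma> (set (map \<tau> xs))"
    using inj_on_inverseI[of "set xs" \<sigma> \<tau>] inj_on_inverseI[of "set (map \<tau> xs)" \<tau> \<sigma>] inv inv'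
    by blast+
  have im: "\<sigma> ` set (map \<tau> xs) = set xs" using inv by force
  have "bij_betw \<tau> ?H ?K"
  proof (rule bij_betw_byWitness[where f' = \<sigma>])
    show "\<forall>x\<in>?H. \<sigma> (\<tau> x) = x" using left_inverse_aff_hull[OF \<tau> \<sigma> inv] by blast
    show "\<forall>y\<in>?K. \<tau> (\<sigma> y) = y" using left_inverse_aff_hull[OF \<sigma> \<tau> inv'] by blast
    show "\<tau> ` ?H \<subseteq> ?K"
      using affine_endo_aff_hull[OF \<tau> inj(1)] by auto
    show "\<sigma> ` ?K \<subseteq> ?H"
      using affine_endo_aff_hull[OF \<sigma> inj(2)] im by auto
  qed
  then show ?thesis
    unfolding cycle_equiv_def
    using xs in_affine_cycles_map[OF \<tau> \<sigma> inv xs] affine_endo_imp_affine_map_on[OF \<tau>] by auto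
qed

lemma cycle_equiv_trans:
  assumes "(us, vs) \<in> cycle_equiv" and "(vs, ws) \<in> cycle_equiv"
  shows "(us, ws) \<in> cycle_equiv"
proof -
  let ?H = "\<lambda>xs. aff_hull (set xs)"
  obtain f where f: "affine_map_on (?H us) f" "bij_betw f (?H us) (?H vs)"
      "\<forall>i<length us. f (us ! i) = vs ! i"
    and l: "us \<in> affine_cycles" "length us = length vs"
    using assms(1) unfolding cycle_equiv_def by blast
  obtain g where g: "affine_map_on (?H vs) g" "bij_betw g (?H vs) (?H ws)"
      "\<forall>i<length vs. g (vs ! i) = ws ! i"
    and l': "ws \<in> affine_cycles" "length vs = length ws"
    using assms(2) unfolding cycle_equiv_def by blast
  have "affine_map_on (?H us) (g \<circ> f)"
    unfolding affine_map_on_def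
  proof (intro allI impI)
    fix T and c :: "'b \<Rightarrow> 'a" assume *: "finite T \<and> T \<subseteq> ?H us \<and> sum c T = 1"
    have inj: "inj_on f T" using f(2) * by (meson bij_betw_def inj_on_subset)
    let ?c = "c \<circ> inv_into T f"
    have "sum ?c (f ` T) = 1" using inj * by (simp add: sum.reindex)
    moreover have "f ` T \<subseteq> ?H vs" using f(2) * by (auto simp: bij_betw_def)
    ultimately have "g (\<Sum>y\<in>f ` T. ?c y *s y) = (\<Sum>y\<in>f ` T. ?c y *s g y)"
      using g(1) * unfolding affine_map_on_def by blast
    then have "g (\<Sum>x\<in>T. c x *s f x) = (\<Sum>x\<in>T. c x *s g (f x))"
      using inj by (simp add: sum.reindex)
    moreover have "f (\<Sum>x\<in>T. c x *s x) = (\<Sum>x\<in>T. c x *s f x)"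
      using f(1) * unfolding affine_map_on_def by blast
    ultimately show "(g \<circ> f) (\<Sum>x\<in>T. c x *s x) = (\<Sum>x\<in>T. c x *s (g \<circ> f) x)" by simp
  qed
  moreover have "bij_betw (g \<circ> f) (?H us) (?H ws)" using f(2) g(2) bij_betw_trans by blast
  ultimately show ?thesis
    unfolding cycle_equiv_def using f g l l' by auto
qed

text \<open>
  A relation is the class of some cycle \<open>z\<close>, and \<open>map \<tau> xs\<close> is equivalent to \<open>xs\<close>; transitivity
  therefore keeps it in the class.
\<close>

lemma rels_map:
  assumes \<tau>: "affine_endo \<tau>" and \<sigma>: "affine_endo \<sigma>" and inv: "\<And>x. x \<in> set xs \<Longrightarrow> \<sigma> (\<tau> x) = x"
    and xs: "xs \<in> rels affine_cycle_structure R"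
  shows "map \<tau> xs \<in> rels affine_cycle_structure R"
proof -
  have R: "R \<in> affine_cycles // cycle_equiv" and "xs \<in> R"
    using xs by (auto simp: affine_cycle_structure_def split: if_splits)
  then obtain z where z: "R = cycle_equiv `` {z}" "(z, xs) \<in> cycle_equiv"
    by (auto simp: quotient_def)
  then have "xs \<in> affine_cycles" by (auto simp: cycle_equiv_def)
  then have "map \<tau> xs \<in> R"
    using z cycle_equiv_trans cycle_equiv_map[OF \<tau> \<sigma> inv] by blast
  then show ?thesis using R by (simp add: affine_cycle_structure_def)
qed

lemma isomorphic_induced_image:
  assumes \<tau>: "affine_endo \<tau>" and \<sigma>: "affine_endo \<sigma>" and inv: "\<And>x. \<sigma> (\<tau> x) = x"
  shows "isomorphic (induced affine_cycle_structure A) (induced affine_cycle_structure (\<tau> ` A))"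
proof -
  have "xs \<in> rels affine_cycle_structure R \<longleftrightarrow> map \<tau> xs \<in> rels affine_cycle_structure R" for xs R
  proof
    show "map \<tau> xs \<in> rels affine_cycle_structure R" if "xs \<in> rels affine_cycle_structure R"
      using rels_map[OF \<tau> \<sigma> inv that] .
    assume "map \<tau> xs \<in> rels affine_cycle_structure R"
    from rels_map[OF \<sigma> \<tau> _ this] have "map \<sigma> (map \<tau> xs) \<in> rels affine_cycle_structure R"
      using inv by force
    then show "xs \<in> rels affine_cycle_structure R" using inv by (simp add: map_idI)
  qed
  moreover have "bij_betw \<tau> A (\<tau> ` A)" using inv by (auto simp: bij_betw_def intro: inj_on_inverseI)
  ultimately show ?thesis
    unfolding isomorphic_def induced_def affine_cycle_structure_def
    by (intro exI[of _ \<tau>]) auto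
qed

section \<open>Monochromatic affine copies\<close>

text \<open>
  An infinite basis \<open>B\<close> is equinumerous with \<open>B \<times> \<nat>\<close>, so it splits into countably many copies
  of itself; \<open>\<phi> j\<close> sends \<open>B\<close> to its \<open>j\<close>-th copy and \<open>\<psi> j\<close> reads that copy off again.
\<close>

lemma independent_coordinate_copies:
  assumes "infinite_dimensional"
  obtains \<phi> \<psi> :: "nat \<Rightarrow> 'b \<Rightarrow> 'b"
  where "\<And>j. Vector_Spaces.linear scale scale (\<phi> j)"
    and "\<And>j. Vector_Spaces.linear scale scale (\<psi> j)"
    and "\<And>i j x. \<psi> i (\<phi> j x) = (if i = j then x else 0)"
proof -
  interpret vector_space_pair scale scale ..
  define B where "B = extend_basis {}"
  have B: "independent B" "span B = UNIV"
    using independent_extend_basis[of "{}"] span_extend_basis[of "{}"]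
    by (simp_all add: B_def independent_empty)
  have "infinite B" using assms B unfolding infinite_dimensional_def by blast
  then have "(card_of (B \<times> (UNIV :: nat set)), card_of B) \<in> ordIso"
    using card_of_Times_infinite_simps(1) infinite_iff_card_of_nat by blast
  then obtain g where g: "inj_on g (B \<times> (UNIV :: nat set))" "g ` (B \<times> UNIV) \<subseteq> B"
    using card_of_ordLeq ordIso_imp_ordLeq by metis
  let ?h = "inv_into (B \<times> UNIV) g"
  define \<phi> where "\<phi> j = construct B (\<lambda>b. g (b, j))" for j :: nat
  define \<psi> where "\<psi> i = construct B (\<lambda>c. if c \<in> g ` (B \<times> {i}) then fst (?h c) else 0)" for i :: nat
  have lin: "Vector_Spaces.linear scale scale (\<phi> j)" "Vector_Spaces.linear scale scale (\<psi> j)" for j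
    unfolding \<phi>_def \<psi>_def using B by (auto intro: linear_construct)
  have "\<psi> i (\<phi> j x) = (if i = j then x else 0)" for i j x
  proof -
    have basis: "\<psi> i (\<phi> j b) = (if i = j then b else 0)" if b: "b \<in> B" for b
    proof -
      have "g (b, j) \<in> B" using g(2) b by blast
      moreover have "g (b, j) \<in> g ` (B \<times> {i}) \<longleftrightarrow> i = j"
        using g(1) b by (auto simp: inj_on_def)
      moreover have "?h (g (b, j)) = (b, j)" using g(1) b by (intro inv_into_f_f) auto
      ultimately show ?thesis
        unfolding \<phi>_def \<psi>_def using b B by (simp add: construct_basis)
    qed
    have "Vector_Spaces.linear scale scale (\<lambda>x. if i = j then x else 0)"
      by (cases "i = j") (simp_all add: linear_zero linear_ident)
    then show ?thesis
      using linear_eq_on[of "\<psi> i \<circ> \<phi> j" "\<lambda>x. if i = j then x else 0" x B] basis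
        Vector_Spaces.linear_compose[OF lin(1) lin(2)] B by simp
  qed
  with lin that show thesis by blast
qed

lemma monochromatic_affine_copy:
  fixes \<chi> :: "'b \<Rightarrow> nat"
  assumes "infinite_dimensional" and "finite A" and "A \<noteq> {}" and bound: "\<And>x. \<chi> x < r"
  obtains \<tau> \<sigma> c where "affine_endo \<tau>" "affine_endo \<sigma>" "\<And>x. \<sigma> (\<tau> x) = x"
    and "\<And>a. a \<in> A \<Longrightarrow> \<chi> (\<tau> a) = c"
proof -
  interpret vector_space_pair scale scale ..
  obtain \<phi> \<psi> :: "nat \<Rightarrow> 'b \<Rightarrow> 'b"
    where \<phi>: "\<And>j. Vector_Spaces.linear scale scale (\<phi> j)"
      and \<psi>: "\<And>j. Vector_Spaces.linear scale scale (\<psi> j)"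
      and \<psi>\<phi>: "\<And>i j x. \<psi> i (\<phi> j x) = (if i = j then x else 0)"
    using independent_coordinate_copies[OF assms(1)] by blast
  define place where "place w = (\<Sum>j<length w. \<phi> j (w ! j))" for w
  have "hales_jewett A" using hales_jewett_theorem assms by blast
  then obtain n where
    "\<And>\<xi> :: 'b list \<Rightarrow> nat. (\<forall>w\<in>words A n. \<xi> w < r) \<Longrightarrow> mono_line A n \<xi>"
    unfolding hales_jewett_def by meson
  from this[of "\<lambda>w. \<chi> (place w)"] bound obtain T c
    where T: "is_line A n T" and c: "\<And>a. a \<in> A \<Longrightarrow> \<chi> (place (fill T a)) = c"
    unfolding mono_line_def by blast
  define J where "J = {j. j < n \<and> T ! j = None}"
  obtain k where k: "k \<in> J"
    using T unfolding is_line_def J_def by (metis (mono_tags, lifting) in_set_conv_nth mem_Collect_eq)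
  define f where "f a = (\<Sum>j\<in>J. \<phi> j a)" for a
  define v where "v = (\<Sum>j\<in>{..<n} - J. \<phi> j (the (T ! j)))"
  have J: "finite J" "J \<subseteq> {..<n}" by (auto simp: J_def)
  have f: "Vector_Spaces.linear scale scale f"
    unfolding f_def by (rule linear_compose_sum) (simp add: \<phi>)
  interpret \<psi>k: Vector_Spaces.linear scale scale "\<psi> k" by (rule \<psi>)
  have place: "place (fill T a) = f a + v" for a
  proof -
    have "length T = n" using T by (simp add: is_line_def)
    then have "place (fill T a) = (\<Sum>j<n. \<phi> j (case_option a id (T ! j)))"
      by (simp add: place_def fill_def)
    also have "\<dots> = (\<Sum>j\<in>{..<n} - J. \<phi> j (case_option a id (T ! j))) +
        (\<Sum>j\<in>J. \<phi> j (case_option a id (T ! j)))"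
      using J by (intro sum.subset_diff) auto
    also have "(\<Sum>j\<in>{..<n} - J. \<phi> j (case_option a id (T ! j))) = v"
      unfolding v_def J_def by (rule sum.cong) auto
    also have "(\<Sum>j\<in>J. \<phi> j (case_option a id (T ! j))) = f a"
      unfolding f_def J_def by (rule sum.cong) auto
    finally show ?thesis by (simp add: add.commute)
  qed
  \<comment> \<open>One active position suffices to recover the letter.\<close>
  have \<psi>f: "\<psi> k (f a) = a" for a
    unfolding f_def using k J by (simp add: \<psi>k.sum \<psi>\<phi>)
  show thesis
  proof (rule that)
    show "affine_endo (\<lambda>a. f a + v)" using f unfolding affine_endo_def by blast
    show "affine_endo (\<lambda>y. \<psi> k y + (- \<psi> k v))" using \<psi> unfolding affine_endo_def by blast
    show "\<psi> k (f a + v) + (- \<psi> k v) = a" for a by (simp add: \<psi>k.add \<psi>f)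
    show "\<chi> (f a + v) = c" if "a \<in> A" for a using c[OF that] place by simp
  qed
qed

end

section \<open>Ages\<close>

lemma isomorphic_trans:
  assumes "isomorphic L M" and "isomorphic M N"
  shows "isomorphic L N"
proof -
  obtain f where f: "bij_betw f (base L) (base M)"
    "\<And>r xs. set xs \<subseteq> base L \<Longrightarrow> xs \<in> rels L r \<longleftrightarrow> map f xs \<in> rels M r"
    using assms(1) unfolding isomorphic_def by blast
  obtain g where g: "bij_betw g (base M) (base N)"
    "\<And>r xs. set xs \<subseteq> base M \<Longrightarrow> xs \<in> rels M r \<longleftrightarrow> map g xs \<in> rels N r"
    using assms(2) unfolding isomorphic_def by blast
  have "xs \<in> rels L r \<longleftrightarrow> map (g \<circ> f) xs \<in> rels N r" if "set xs \<subseteq> base L" for r xs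
  proof -
    have "set (map f xs) \<subseteq> base M" using that f(1) by (auto simp: bij_betw_def)
    then show ?thesis using f(2)[OF that] g(2) by simp
  qed
  then show ?thesis unfolding isomorphic_def using bij_betw_trans[OF f(1) g(1)] by blast
qed

lemma induced_induced: "A \<subseteq> P \<Longrightarrow> induced (induced M P) A = induced M A"
  by (auto simp: induced_def)

lemma age_induced_eq:
  assumes "\<And>A. A \<subseteq> base M \<Longrightarrow> A \<noteq> {} \<Longrightarrow> finite A \<Longrightarrow>
    \<exists>A'. A' \<subseteq> base M \<inter> P \<and> A' \<noteq> {} \<and> finite A' \<and> isomorphic (induced M A) (induced M A')"
  shows "age (induced M P) = age M"
proof
  have base: "base (induced M P) = base M \<inter> P" by (simp add: induced_def)
  show "age (induced M P) \<subseteq> age M"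
  proof
    fix N assume "N \<in> age (induced M P)"
    then obtain A where N: "is_relstruct N" "finite (base N)"
      and A: "A \<subseteq> base M \<inter> P" "A \<noteq> {}" "finite A"
      and "isomorphic N (induced (induced M P) A)"
      unfolding age_def base by blast
    then have "isomorphic N (induced M A)" using induced_induced[of A P M] by simp
    then show "N \<in> age M" using N A unfolding age_def by blast
  qed
  show "age M \<subseteq> age (induced M P)"
  proof
    fix N assume N: "N \<in> age M"
    then obtain A where A: "A \<subseteq> base M" "A \<noteq> {}" "finite A" and iso: "isomorphic N (induced M A)"
      unfolding age_def by blast
    from assms[OF A] obtain A' where A': "A' \<subseteq> base M \<inter> P" "A' \<noteq> {}" "finite A'"
      and "isomorphic (induced M A) (induced M A')" by blast
    then have "isomorphic N (induced (induced M P) A')"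
      using iso isomorphic_trans induced_induced[of A' P M] by auto
    then show "N \<in> age (induced M P)" using N A' unfolding age_def base by blast
  qed
qed

theorem mainTheorem4:
  fixes scale :: "'k::field \<Rightarrow> 'v::ab_group_add \<Rightarrow> 'v"
  assumes "vector_space scale"
    and "vector_space.infinite_dimensional scale"
  shows "age_indivisible (vector_space.affine_cycle_structure scale)"
proof -
  interpret vector_space scale by (rule assms(1))
  let ?M = affine_cycle_structure
  have base: "base ?M = UNIV" by (simp add: affine_cycle_structure_def)
  have "\<exists>i\<in>{0, 1}. age (induced ?M (P i)) = age ?M"
    if "P 0 \<union> P 1 = UNIV" for P :: "nat \<Rightarrow> 'v set"
  proof -
    define copied where "copied A Q \<longleftrightarrow>
      (\<exists>\<tau> \<sigma>. affine_endo \<tau> \<and> affine_endo \<sigma> \<and> (\<forall>x. \<sigma> (\<tau> x) = x) \<and> \<tau> ` A \<subseteq> Q)" for A Q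
    have pigeonhole: "copied A (P 0) \<or> copied A (P 1)" if A: "finite A" "A \<noteq> {}" for A
    proof -
      let ?\<chi> = "\<lambda>x. if x \<in> P 0 then 0 else 1 :: nat"
      have two: "?\<chi> x < 2" for x by simp
      obtain \<tau> \<sigma> c where \<tau>: "affine_endo \<tau>" "affine_endo \<sigma>" "\<And>x. \<sigma> (\<tau> x) = x"
        and c: "\<And>a. a \<in> A \<Longrightarrow> ?\<chi> (\<tau> a) = c"
        using monochromatic_affine_copy[where \<chi> = ?\<chi>, OF assms(2) A two] by blast
      have "\<tau> ` A \<subseteq> P 0 \<or> \<tau> ` A \<subseteq> P 1"
      proof (cases "c = 0")
        case True
        then have "\<tau> a \<in> P 0" if "a \<in> A" for a
          using c[OF that] by (metis zero_neq_one)
        then show ?thesis by blast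
      next
        case False
        then have "\<tau> ` A \<inter> P 0 = {}" using c by fastforce
        then show ?thesis using \<open>P 0 \<union> P 1 = UNIV\<close> by blast
      qed
      then show ?thesis unfolding copied_def using \<tau> by blast
    qed
    have copied_mono: "copied A Q" if "copied B Q" "A \<subseteq> B" for A B Q
      using that unfolding copied_def by (meson image_mono order_trans)
    have "\<exists>i\<in>{0, 1}. \<forall>A. finite A \<and> A \<noteq> {} \<longrightarrow> copied A (P i)"
    proof (rule ccontr)
      assume "\<not> ?thesis"
      then obtain A B where A: "finite A" "A \<noteq> {}" "\<not> copied A (P 0)"
        and B: "finite B" "\<not> copied B (P 1)" by auto
      then show False using pigeonhole[of "A \<union> B"] copied_mono by blast
    qed
    then obtain i where i: "i \<in> {0, 1}" "\<And>A. finite A \<Longrightarrow> A \<noteq> {} \<Longrightarrow> copied A (P i)" by blast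
    have "age (induced ?M (P i)) = age ?M"
    proof (rule age_induced_eq)
      fix A :: "'v set" assume A: "A \<noteq> {}" "finite A"
      then obtain \<tau> \<sigma> where \<tau>: "affine_endo \<tau>" "affine_endo \<sigma>" "\<And>x. \<sigma> (\<tau> x) = x"
        and sub: "\<tau> ` A \<subseteq> P i"
        using i(2) unfolding copied_def by blast
      show "\<exists>A'. A' \<subseteq> base ?M \<inter> P i \<and> A' \<noteq> {} \<and> finite A' \<and>
          isomorphic (induced ?M A) (induced ?M A')"
        using isomorphic_induced_image[OF \<tau>] sub A base by (intro exI[of _ "\<tau> ` A"]) auto
    qed
    with i(1) show ?thesis by blast
  qed
  then show ?thesis unfolding age_indivisible_def base by blast
qed

end
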